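(* For any LL(1) syntax $s$, token sequence $ts$ and value $v$: $$\mathtt{parse}(\mathtt{focus}(s), ts) = \mathtt{some}(v) \iff s \vdash ts \leadsto v .$$
   Context: **Values, types, tokens.** Fix a set $\mathcal V$ of values, a set $\mathcal T$ of types and a relation $v : T$ ("$v$ has type $T$"). Values and types are closed under pairing, and $(v_1,v_2):(T_1,T_2)$ iff $v_1:T_1$ and $v_2:T_2$. $T_1\to T_2$ is the set of total functions from values of type $T_1$ to values of type $T_2$. A distinguished type $\mathtt{Token}\in\mathcal T$ is fixed; values of type $\mathtt{Token}$ are tokens. There is a finite set $\mathcal K$ of kinds; each token $t$ has exactly one kind $\mathtt{getKind}(t)\in\mathcal K$, and every kind is the kind of at least one token. $\langle\rangle$ is the empty sequence, $\mathbin{++}$ concatenation, $x :: xs$ prepending. **Syntaxes.** For each type $T$ let $\Sigma_T$ be a finite set of identifiers. The sets $\mathcal S_T$ of syntaxes are defined inductively: $\mathit{elem}_k\in\mathcal S_{\mathtt{Token}}$ for $k\in\mathcal K$; $\bot\in\mathcal S_T$; $\varepsilon_v\in\mathcal S_T$ if $v:T$; $s_1\vee s_2\in\mathcal S_T$ if $s_1,s_2\in\mathcal S_T$; $s_1\cdot s_2\in\mathcal S_{(T_1,T_2)}$ if $s_1\in\mathcal S_{T_1}$, $s_2\in\mathcal S_{T_2}$; $f\circledcirc s\in\mathcal S_{T_2}$ if $s\in\mathcal S_{T_1}$, $f\in T_1\to T_2$; $\mathit{var}_x\in\mathcal S_T$ if $x\in\Sigma_T$. A fixed global environment, which is a finite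 mapping, assigns to each identifier $x\in\Sigma_T$ a syntax $\mathtt{getDef}(x)\in\mathcal S_T$. **Semantics.** $s\vdash ts\leadsto v$ is the least relation with: $\mathit{elem}_k\vdash\langle t\rangle\leadsto t$ if $\mathtt{getKind}(t)=k$; $\varepsilon_v\vdash\langle\rangle\leadsto v$; $s_1\vee s_2\vdash ts\leadsto v$ if $s_1\vdash ts\leadsto v$ or $s_2\vdash ts\leadsto v$; $s_1\cdot s_2\vdash ts_1\mathbin{++}ts_2\leadsto(v_1,v_2)$ if $s_1\vdash ts_1\leadsto v_1$ and $s_2\vdash ts_2\leadsto v_2$; $f\circledcirc s\vdash ts\leadsto f(v)$ if $s\vdash ts\leadsto v$; $\mathit{var}_x\vdash ts\leadsto v$ if $\mathtt{getDef}(x)\vdash ts\leadsto v$. **Properties** (each the least predicate/set closed under the listed rules). PRODUCTIVE: $\varepsilon_v$, $\mathit{elem}_k$ always; $s_1\vee s_2$ if $s_1$ or $s_2$ is; $s_1\cdot s_2$ if both are; $f\circledcirc s$ if $s$ is; $\mathit{var}_x$ if $\mathtt{getDef}(x)$ is. NULLABLE$(s,v)$: NULLABLE$(\varepsilon_v,v)$; NULLABLE$(s_1\vee s_2,v)$ if NULLABLE$(s_1,v)$ or NULLABLE$(s_2,v)$; NULLABLE$(s_1\cdot s_2,(v_1,v_2))$ if NULLABLE$(s_1,v_1)$ and NULLABLE$(s_2,v_2)$; NULLABLE$(f\circledcirc s,f(v))$ if NULLABLE$(s,v)$; NULLABLE$(\mathit{var}_x,v)$ if NULLABLE$(\mathtt{getDef}(x),v)$.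 "$s$ nullable" means NULLABLE$(s,v)$ for some $v$. The function $\mathtt{nullable}(s)$ returns $\mathtt{some}(v)$ for an arbitrary (fixed) $v$ with NULLABLE$(s,v)$ if one exists, and $\mathtt{none}$ otherwise. FIRST: $k\in$ FIRST$(\mathit{elem}_k)$; $k\in$ FIRST$(s_1\vee s_2)$ if $k\in$ FIRST$(s_1)$ or $k\in$ FIRST$(s_2)$; $k\in$ FIRST$(s_1\cdot s_2)$ if ($k\in$ FIRST$(s_1)$ and $s_2$ productive) or ($s_1$ nullable and $k\in$ FIRST$(s_2)$); $k\in$ FIRST$(f\circledcirc s)$ if $k\in$ FIRST$(s)$; $k\in$ FIRST$(\mathit{var}_x)$ if $k\in$ FIRST$(\mathtt{getDef}(x))$. SNF (should-not-follow set): $k\in$ SNF$(s_1\vee s_2)$ if $k\in$ SNF$(s_1)$, or $k\in$ SNF$(s_2)$, or ($k\in$ FIRST$(s_1)$ and $s_2$ nullable), or ($s_1$ nullable and $k\in$ FIRST$(s_2)$); $k\in$ SNF$(s_1\cdot s_2)$ if ($k\in$ SNF$(s_1)$ and $s_2$ nullable) or ($s_1$ productive and $k\in$ SNF$(s_2)$); $k\in$ SNF$(f\circledcirc s)$ if $k\in$ SNF$(s)$; $k\in$ SNF$(\mathit{var}_x)$ if $k\in$ SNF$(\mathtt{getDef}(x))$. HAS-CONFLICT: $s_1\vee s_2$ if both are nullable, or FIRST$(s_1)\cap$ FIRST$(s_2)\neq\emptyset$, or $s_1$ or $s_2$ has a conflict; $s_1\cdot s_2$ if SNF$(s_1)\cap$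 FIRST$(s_2)\ne\emptyset$, or $s_1$ or $s_2$ has a conflict; $f\circledcirc s$ if $s$ has a conflict; $\mathit{var}_x$ if $\mathtt{getDef}(x)$ has a conflict. A syntax is LL(1) iff it has no conflict. **Focused syntaxes.** Layers $\mathcal L^{T_1}_{T_2}$ (above type $T_1$, below type $T_2$): $\mathtt{apply}(f)\in\mathcal L^{T_1}_{T_2}$ for $f\in T_1\to T_2$; $\mathtt{prepend}(v)\in\mathcal L^{T_2}_{(T_1,T_2)}$ for $v:T_1$; $\mathtt{follow\text{-}by}(s)\in\mathcal L^{T_1}_{(T_1,T_2)}$ for $s\in\mathcal S_{T_2}$. A context in $\mathcal C^{T_1}_{T_2}$ is a finite stack of layers, type-aligned (each layer's below type equals the next layer's above type), the first layer having above type $T_1$ and the last having below type $T_2$; the empty stack is in $\mathcal C^T_T$. A focused syntax is a pair $(s,c)$ with $s\in\mathcal S_{T'}$, $c\in\mathcal C^{T'}_T$. **Operations.** $\mathtt{focus}(s)=(s,\langle\rangle)$. $\mathtt{plug}(v,c)$: $\mathtt{plug}(v,\langle\rangle)=(\varepsilon_v,\langle\rangle)$; $\mathtt{plug}(v,\mathtt{apply}(f)::c')=\mathtt{plug}(f(v),c')$; $\mathtt{plug}(v,\mathtt{prepend}(v')::c')=\mathtt{plug}((v',v),c')$; $\mathtt{plug}(v,\mathtt{follow\text{-}by}(s)::c')=(s,\mathtt{prepend}(v)::c')$. $\mathtt{locate}(k,(s,c))$: if $k\in$ FIRST$(s)$ return $\mathtt{some}((s,c))$; otherwise, if $\mathtt{nullable}(s)=\mathtt{none}$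 return $\mathtt{none}$; if $\mathtt{nullable}(s)=\mathtt{some}(v)$, return $\mathtt{none}$ if $c=\langle\rangle$, else $\mathtt{locate}(k,\mathtt{plug}(v,c))$. $\mathtt{pierce}(k,s,c)$ (used for $s$ LL(1) with $k\in$ FIRST$(s)$): $\mathtt{pierce}(k,\mathit{elem}_k,c)=c$; $\mathtt{pierce}(k,s_1\vee s_2,c)=\mathtt{pierce}(k,s_1,c)$ if $k\in$ FIRST$(s_1)$, else $\mathtt{pierce}(k,s_2,c)$; $\mathtt{pierce}(k,s_1\cdot s_2,c)=\mathtt{pierce}(k,s_2,\mathtt{prepend}(v)::c)$ if $\mathtt{nullable}(s_1)=\mathtt{some}(v)$ and $k\notin$ FIRST$(s_1)$, else $\mathtt{pierce}(k,s_1,\mathtt{follow\text{-}by}(s_2)::c)$; $\mathtt{pierce}(k,f\circledcirc s',c)=\mathtt{pierce}(k,s',\mathtt{apply}(f)::c)$; $\mathtt{pierce}(k,\mathit{var}_x,c)=\mathtt{pierce}(k,\mathtt{getDef}(x),c)$. $\mathtt{derive}(t,(s,c))$: with $k=\mathtt{getKind}(t)$, return $\mathtt{none}$ if $\mathtt{locate}(k,(s,c))=\mathtt{none}$, and $\mathtt{some}((\varepsilon_t,\mathtt{pierce}(k,s',c')))$ if $\mathtt{locate}(k,(s,c))=\mathtt{some}((s',c'))$. $\mathtt{result}(s,c)$: $\mathtt{none}$ if $\mathtt{nullable}(s)=\mathtt{none}$; if $\mathtt{nullable}(s)=\mathtt{some}(v)$, it is $\mathtt{some}(v)$ when $c=\langle\rangle$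 and $\mathtt{result}(\mathtt{plug}(v,c))$ otherwise. $\mathtt{parse}((s,c),ts)$: $\mathtt{parse}((s,c),\langle\rangle)=\mathtt{result}(s,c)$; $\mathtt{parse}((s,c),t::ts')$ is $\mathtt{none}$ if $\mathtt{derive}(t,(s,c))=\mathtt{none}$, and $\mathtt{parse}((s',c'),ts')$ if $\mathtt{derive}(t,(s,c))=\mathtt{some}((s',c'))$. *)

theory Defs
  imports Main "HOL-Library.FuncSet"
begin

text \<open>
  Syntaxes are raw terms; membership in the type-indexed sets of syntaxes is the predicate
  \<open>is_syntax\<close> below.
\<close>

datatype ('v, 'k, 'x) syn =
    Elem 'k
  | Bot
  | Eps 'v
  | Disj "('v, 'k, 'x) syn" "('v, 'k, 'x) syn"
  | Seq "('v, 'k, 'x) syn" "('v, 'k, 'x) syn"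
  | Map "'v \<Rightarrow> 'v" "('v, 'k, 'x) syn"
  | Var 'x

text \<open>
  The fixed data of the theory. Values are the elements of \<open>'v\<close> and types those of \<open>'ty\<close>.
  The function \<open>kind_of\<close> matters only on values of type \<open>token_type\<close>, and \<open>get_def\<close> only on
  the identifiers in some set \<open>ids T\<close>.
\<close>

record ('v, 'ty, 'k, 'x) setting =
  val_pair :: "'v \<Rightarrow> 'v \<Rightarrow> 'v"
  type_pair :: "'ty \<Rightarrow> 'ty \<Rightarrow> 'ty"
  has_type :: "'v \<Rightarrow> 'ty \<Rightarrow> bool"
  token_type :: 'ty
  kinds :: "'k set"
  kind_of :: "'v \<Rightarrow> 'k"
  ids :: "'ty \<Rightarrow> 'x set"
  get_def :: "'x \<Rightarrow> ('v, 'k, 'x) syn"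

definition vals :: "('v, 'ty, 'k, 'x) setting \<Rightarrow> 'ty \<Rightarrow> 'v set" where
  "vals G T = {v. has_type G v T}"

definition tokens :: "('v, 'ty, 'k, 'x) setting \<Rightarrow> 'v set" where
  "tokens G = vals G (token_type G)"

text \<open>
  A function from values of type \<open>T1\<close> to values of type \<open>T2\<close> is represented by its unique
  extensional HOL representative.
\<close>

inductive is_syntax :: "('v, 'ty, 'k, 'x) setting \<Rightarrow> 'ty \<Rightarrow> ('v, 'k, 'x) syn \<Rightarrow> bool"
  for G where
  elem: "k \<in> kinds G \<Longrightarrow> is_syntax G (token_type G) (Elem k)"
| bot: "is_syntax G T Bot"
| eps: "has_type G v T \<Longrightarrow> is_syntax G T (Eps v)"
| disj: "is_syntax G T s1 \<Longrightarrow> is_syntax G T s2 \<Longrightarrow> is_syntax G T (Disj s1 s2)"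
| seq: "is_syntax G T1 s1 \<Longrightarrow> is_syntax G T2 s2 \<Longrightarrow>
    is_syntax G (type_pair G T1 T2) (Seq s1 s2)"
| map: "is_syntax G T1 s \<Longrightarrow> f \<in> vals G T1 \<rightarrow>\<^sub>E vals G T2 \<Longrightarrow> is_syntax G T2 (Map f s)"
| var: "x \<in> ids G T \<Longrightarrow> is_syntax G T (Var x)"

text \<open>
  Injectivity expresses that \<open>val_pair\<close> and \<open>type_pair\<close> form ordered pairs. The assumption
  \<open>finite_env\<close> says that the environment is a finite mapping; it includes the finiteness of
  each individual \<open>ids G T\<close>.
\<close>

locale syntax_setting =
  fixes G :: "('v, 'ty, 'k, 'x) setting"
  assumes val_pair_inject:
      "val_pair G v1 v2 = val_pair G w1 w2 \<longleftrightarrow> v1 = w1 \<and> v2 = w2"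
    and type_pair_inject:
      "type_pair G T1 T2 = type_pair G U1 U2 \<longleftrightarrow> T1 = U1 \<and> T2 = U2"
    and has_type_pair:
      "has_type G (val_pair G v1 v2) (type_pair G T1 T2) \<longleftrightarrow> has_type G v1 T1 \<and> has_type G v2 T2"
    and finite_kinds: "finite (kinds G)"
    and kind_of_tokens: "kind_of G ` tokens G = kinds G"
    and finite_env: "finite (\<Union>T. ids G T)"
    and get_def_typed: "x \<in> ids G T \<Longrightarrow> is_syntax G T (get_def G x)"

inductive matches :: "('v, 'ty, 'k, 'x) setting \<Rightarrow> ('v, 'k, 'x) syn \<Rightarrow> 'v list \<Rightarrow> 'v \<Rightarrow> bool"
  for G where
  elem: "t \<in> tokens G \<Longrightarrow> kind_of G t = k \<Longrightarrow> matches G (Elem k) [t] t"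
| eps: "matches G (Eps v) [] v"
| disj1: "matches G s1 ts v \<Longrightarrow> matches G (Disj s1 s2) ts v"
| disj2: "matches G s2 ts v \<Longrightarrow> matches G (Disj s1 s2) ts v"
| seq: "matches G s1 ts1 v1 \<Longrightarrow> matches G s2 ts2 v2 \<Longrightarrow>
    matches G (Seq s1 s2) (ts1 @ ts2) (val_pair G v1 v2)"
| map: "matches G s ts v \<Longrightarrow> matches G (Map f s) ts (f v)"
| var: "matches G (get_def G x) ts v \<Longrightarrow> matches G (Var x) ts v"

inductive productive :: "('v, 'ty, 'k, 'x) setting \<Rightarrow> ('v, 'k, 'x) syn \<Rightarrow> bool"
  for G where
  eps: "productive G (Eps v)"
| elem: "productive G (Elem k)"
| disj1: "productive G s1 \<Longrightarrow> productive G (Disj s1 s2)"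
| disj2: "productive G s2 \<Longrightarrow> productive G (Disj s1 s2)"
| seq: "productive G s1 \<Longrightarrow> productive G s2 \<Longrightarrow> productive G (Seq s1 s2)"
| map: "productive G s \<Longrightarrow> productive G (Map f s)"
| var: "productive G (get_def G x) \<Longrightarrow> productive G (Var x)"

inductive nullable_with :: "('v, 'ty, 'k, 'x) setting \<Rightarrow> ('v, 'k, 'x) syn \<Rightarrow> 'v \<Rightarrow> bool"
  for G where
  eps: "nullable_with G (Eps v) v"
| disj1: "nullable_with G s1 v \<Longrightarrow> nullable_with G (Disj s1 s2) v"
| disj2: "nullable_with G s2 v \<Longrightarrow> nullable_with G (Disj s1 s2) v"
| seq: "nullable_with G s1 v1 \<Longrightarrow> nullable_with G s2 v2 \<Longrightarrow>
    nullable_with G (Seq s1 s2) (val_pair G v1 v2)"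
| map: "nullable_with G s v \<Longrightarrow> nullable_with G (Map f s) (f v)"
| var: "nullable_with G (get_def G x) v \<Longrightarrow> nullable_with G (Var x) v"

definition is_nullable :: "('v, 'ty, 'k, 'x) setting \<Rightarrow> ('v, 'k, 'x) syn \<Rightarrow> bool" where
  "is_nullable G s \<longleftrightarrow> (\<exists>v. nullable_with G s v)"

definition nullable :: "('v, 'ty, 'k, 'x) setting \<Rightarrow> ('v, 'k, 'x) syn \<Rightarrow> 'v option" where
  "nullable G s = (if is_nullable G s then Some (SOME v. nullable_with G s v) else None)"

inductive in_first :: "('v, 'ty, 'k, 'x) setting \<Rightarrow> 'k \<Rightarrow> ('v, 'k, 'x) syn \<Rightarrow> bool"
  for G k where
  elem: "in_first G k (Elem k)"
| disj1: "in_first G k s1 \<Longrightarrow> in_first G k (Disj s1 s2)"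
| disj2: "in_first G k s2 \<Longrightarrow> in_first G k (Disj s1 s2)"
| seq1: "in_first G k s1 \<Longrightarrow> productive G s2 \<Longrightarrow> in_first G k (Seq s1 s2)"
| seq2: "is_nullable G s1 \<Longrightarrow> in_first G k s2 \<Longrightarrow> in_first G k (Seq s1 s2)"
| map: "in_first G k s \<Longrightarrow> in_first G k (Map f s)"
| var: "in_first G k (get_def G x) \<Longrightarrow> in_first G k (Var x)"

definition FIRST :: "('v, 'ty, 'k, 'x) setting \<Rightarrow> ('v, 'k, 'x) syn \<Rightarrow> 'k set" where
  "FIRST G s = {k. in_first G k s}"

inductive in_snf :: "('v, 'ty, 'k, 'x) setting \<Rightarrow> 'k \<Rightarrow> ('v, 'k, 'x) syn \<Rightarrow> bool"
  for G k where
  disj1: "in_snf G k s1 \<Longrightarrow> in_snf G k (Disj s1 s2)"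
| disj2: "in_snf G k s2 \<Longrightarrow> in_snf G k (Disj s1 s2)"
| disj3: "k \<in> FIRST G s1 \<Longrightarrow> is_nullable G s2 \<Longrightarrow> in_snf G k (Disj s1 s2)"
| disj4: "is_nullable G s1 \<Longrightarrow> k \<in> FIRST G s2 \<Longrightarrow> in_snf G k (Disj s1 s2)"
| seq1: "in_snf G k s1 \<Longrightarrow> is_nullable G s2 \<Longrightarrow> in_snf G k (Seq s1 s2)"
| seq2: "productive G s1 \<Longrightarrow> in_snf G k s2 \<Longrightarrow> in_snf G k (Seq s1 s2)"
| map: "in_snf G k s \<Longrightarrow> in_snf G k (Map f s)"
| var: "in_snf G k (get_def G x) \<Longrightarrow> in_snf G k (Var x)"

definition SNF :: "('v, 'ty, 'k, 'x) setting \<Rightarrow> ('v, 'k, 'x) syn \<Rightarrow> 'k set" where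
  "SNF G s = {k. in_snf G k s}"

inductive has_conflict :: "('v, 'ty, 'k, 'x) setting \<Rightarrow> ('v, 'k, 'x) syn \<Rightarrow> bool"
  for G where
  disj_null: "is_nullable G s1 \<Longrightarrow> is_nullable G s2 \<Longrightarrow> has_conflict G (Disj s1 s2)"
| disj_first: "FIRST G s1 \<inter> FIRST G s2 \<noteq> {} \<Longrightarrow> has_conflict G (Disj s1 s2)"
| disj1: "has_conflict G s1 \<Longrightarrow> has_conflict G (Disj s1 s2)"
| disj2: "has_conflict G s2 \<Longrightarrow> has_conflict G (Disj s1 s2)"
| seq_follow: "SNF G s1 \<inter> FIRST G s2 \<noteq> {} \<Longrightarrow> has_conflict G (Seq s1 s2)"
| seq1: "has_conflict G s1 \<Longrightarrow> has_conflict G (Seq s1 s2)"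
| seq2: "has_conflict G s2 \<Longrightarrow> has_conflict G (Seq s1 s2)"
| map: "has_conflict G s \<Longrightarrow> has_conflict G (Map f s)"
| var: "has_conflict G (get_def G x) \<Longrightarrow> has_conflict G (Var x)"

definition LL1 :: "('v, 'ty, 'k, 'x) setting \<Rightarrow> ('v, 'k, 'x) syn \<Rightarrow> bool" where
  "LL1 G s \<longleftrightarrow> \<not> has_conflict G s"

datatype ('v, 'k, 'x) layer =
    Apply "'v \<Rightarrow> 'v"
  | Prepend 'v
  | Follow_by "('v, 'k, 'x) syn"

type_synonym ('v, 'k, 'x) ctxt = "('v, 'k, 'x) layer list"

type_synonym ('v, 'k, 'x) focused = "('v, 'k, 'x) syn \<times> ('v, 'k, 'x) ctxt"

text \<open>
  As for syntaxes, typing of layers, contexts and focused syntaxes is a predicate on raw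
  terms. In \<open>is_layer G T1 T2\<close> and \<open>is_context G T1 T2\<close>, \<open>T1\<close> is the type above and \<open>T2\<close>
  the type below. The operations are defined on all raw focused syntaxes.
\<close>

inductive is_layer :: "('v, 'ty, 'k, 'x) setting \<Rightarrow> 'ty \<Rightarrow> 'ty \<Rightarrow> ('v, 'k, 'x) layer \<Rightarrow> bool"
  for G where
  apply_fun: "f \<in> vals G T1 \<rightarrow>\<^sub>E vals G T2 \<Longrightarrow> is_layer G T1 T2 (Apply f)"
| prepend: "has_type G v T1 \<Longrightarrow> is_layer G T2 (type_pair G T1 T2) (Prepend v)"
| follow_by: "is_syntax G T2 s \<Longrightarrow> is_layer G T1 (type_pair G T1 T2) (Follow_by s)"

inductive is_context :: "('v, 'ty, 'k, 'x) setting \<Rightarrow> 'ty \<Rightarrow> 'ty \<Rightarrow> ('v, 'k, 'x) ctxt \<Rightarrow> bool"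
  for G where
  empty: "is_context G T T []"
| layer: "is_layer G T1 T2 l \<Longrightarrow> is_context G T2 T3 c \<Longrightarrow> is_context G T1 T3 (l # c)"

definition is_focused :: "('v, 'ty, 'k, 'x) setting \<Rightarrow> 'ty \<Rightarrow> ('v, 'k, 'x) focused \<Rightarrow> bool" where
  "is_focused G T = (\<lambda>(s, c). \<exists>T'. is_syntax G T' s \<and> is_context G T' T c)"

definition focus :: "('v, 'k, 'x) syn \<Rightarrow> ('v, 'k, 'x) focused" where
  "focus s = (s, [])"

lemma is_focused_focus: "is_syntax G T s \<Longrightarrow> is_focused G T (focus s)"
  by (auto simp: is_focused_def focus_def intro: is_context.intros)

fun plug :: "('v, 'ty, 'k, 'x) setting \<Rightarrow> 'v \<Rightarrow> ('v, 'k, 'x) ctxt \<Rightarrow> ('v, 'k, 'x) focused" where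
  "plug G v [] = (Eps v, [])"
| "plug G v (Apply f # c) = plug G (f v) c"
| "plug G v (Prepend v' # c) = plug G (val_pair G v' v) c"
| "plug G v (Follow_by s # c) = (s, Prepend v # c)"

lemma (in syntax_setting) is_focused_plug:
  assumes "has_type G v T'" "is_context G T' T c"
  shows "is_focused G T (plug G v c)"
  using assms(2, 1)
proof (induction arbitrary: v rule: is_context.induct)
  case (empty T)
  then show ?case
    by (auto simp: is_focused_def intro: is_syntax.eps is_context.empty)
next
  case (layer T1 T2 l T3 c)
  from layer.hyps(1) show ?case
  proof cases
    case (apply_fun f)
    then show ?thesis
      using layer.IH[of "f v"] layer.prems by (auto simp: vals_def)
  next
    case (prepend v' T')
    then show ?thesis
      using layer.IH[of "val_pair G v' v"] layer.prems by (simp add: has_type_pair)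
  next
    case (follow_by T' s)
    then show ?thesis
      using layer.prems layer.hyps
      by (auto simp: is_focused_def intro!: exI[of _ T'] is_context.layer is_layer.prepend)
  qed
qed

text \<open>
  Each unfolding of \<open>locate\<close> or \<open>result\<close> through \<open>plug\<close> either consumes a \<open>Follow_by\<close> layer
  or empties a nonempty context that has none.
\<close>

definition plug_measure :: "('v, 'k, 'x) ctxt \<Rightarrow> nat" where
  "plug_measure c = length (filter (\<lambda>l. \<exists>s. l = Follow_by s) c) + (if c = [] then 0 else 1)"

lemma plug_measure_less:
  assumes "c \<noteq> []"
  shows "plug_measure (snd (plug G v c)) < plug_measure c"
proof -
  have "length (filter (\<lambda>l. \<exists>s. l = Follow_by s) (snd (plug G v c))) <
          length (filter (\<lambda>l. \<exists>s. l = Follow_by s) c) \<or> snd (plug G v c) = []"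
    by (induction G v c rule: plug.induct) auto
  moreover have "length (filter (\<lambda>l. \<exists>s. l = Follow_by s) (snd (plug G v c))) \<le>
          length (filter (\<lambda>l. \<exists>s. l = Follow_by s) c)"
    by (induction G v c rule: plug.induct) auto
  ultimately show ?thesis
    using assms by (auto simp: plug_measure_def)
qed

function locate ::
  "('v, 'ty, 'k, 'x) setting \<Rightarrow> 'k \<Rightarrow> ('v, 'k, 'x) focused \<Rightarrow> ('v, 'k, 'x) focused option" where
  "locate G k (s, c) =
    (if k \<in> FIRST G s then Some (s, c)
     else case nullable G s of
       None \<Rightarrow> None
     | Some v \<Rightarrow> if c = [] then None else locate G k (plug G v c))"
  by pat_completeness auto
termination
  by (relation "measure (\<lambda>(G, k, s, c). plug_measure c)")
    (auto dest: plug_measure_less simp: case_prod_beta)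

text \<open>
  The recursion of \<open>pierce\<close> may diverge on left-recursive syntaxes that are not LL(1), and it
  is stuck on \<open>Bot\<close>, \<open>Eps v\<close> and \<open>Elem k'\<close> with \<open>k' \<noteq> k\<close>. Since it is tail recursive, its
  defining equation holds unconditionally, with \<open>undefined\<close> as the value in those cases.
\<close>

partial_function (tailrec) pierce ::
  "('v, 'ty, 'k, 'x) setting \<Rightarrow> 'k \<Rightarrow> ('v, 'k, 'x) syn \<Rightarrow> ('v, 'k, 'x) ctxt \<Rightarrow> ('v, 'k, 'x) ctxt"
where
  "pierce G k s c = (case s of
      Elem k' \<Rightarrow> if k' = k then c else undefined
    | Bot \<Rightarrow> undefined
    | Eps v \<Rightarrow> undefined
    | Disj s1 s2 \<Rightarrow> if k \<in> FIRST G s1 then pierce G k s1 c else pierce G k s2 c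
    | Seq s1 s2 \<Rightarrow>
        (case nullable G s1 of
          None \<Rightarrow> pierce G k s1 (Follow_by s2 # c)
        | Some v \<Rightarrow>
            if k \<notin> FIRST G s1 then pierce G k s2 (Prepend v # c)
            else pierce G k s1 (Follow_by s2 # c))
    | Map f s' \<Rightarrow> pierce G k s' (Apply f # c)
    | Var x \<Rightarrow> pierce G k (get_def G x) c)"

definition derive_token ::
  "('v, 'ty, 'k, 'x) setting \<Rightarrow> 'v \<Rightarrow> ('v, 'k, 'x) focused \<Rightarrow> ('v, 'k, 'x) focused option" where
  "derive_token G t sc =
    (case locate G (kind_of G t) sc of
       None \<Rightarrow> None
     | Some (s', c') \<Rightarrow> Some (Eps t, pierce G (kind_of G t) s' c'))"

function result :: "('v, 'ty, 'k, 'x) setting \<Rightarrow> ('v, 'k, 'x) focused \<Rightarrow> 'v option" where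
  "result G (s, c) =
    (case nullable G s of
       None \<Rightarrow> None
     | Some v \<Rightarrow> if c = [] then Some v else result G (plug G v c))"
  by pat_completeness auto
termination
  by (relation "measure (\<lambda>(G, s, c). plug_measure c)")
    (auto dest: plug_measure_less simp: case_prod_beta)

fun parse :: "('v, 'ty, 'k, 'x) setting \<Rightarrow> ('v, 'k, 'x) focused \<Rightarrow> 'v list \<Rightarrow> 'v option" where
  "parse G sc [] = result G sc"
| "parse G sc (t # ts) =
    (case derive_token G t sc of None \<Rightarrow> None | Some sc' \<Rightarrow> parse G sc' ts)"

end

theory Submission
  imports Defs
begin

text \<open>
  A focused syntax denotes the plain syntax obtained by folding its context around its focus.
  The LL(1) property of this unfocused syntax is an invariant of \<open>locate\<close>, \<open>pierce\<close> and
  \<open>derive_token\<close>, because a conflict at a hole of a context depends on the syntax in the hole only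
  through productivity, should-not-follow set and conflicts. Under the invariant a focus with
  the next kind in its first set cannot match the empty sequence: it would be nullable, the kind
  would lie in its should-not-follow set, and the context would begin with that kind. So each
  step preserves the matches of the unfocused syntax.
\<close>

fun unfocus :: "('v, 'k, 'x) syn \<Rightarrow> ('v, 'k, 'x) ctxt \<Rightarrow> ('v, 'k, 'x) syn" where
  "unfocus s [] = s"
| "unfocus s (Apply f # c) = unfocus (Map f s) c"
| "unfocus s (Prepend v # c) = unfocus (Seq (Eps v) s) c"
| "unfocus s (Follow_by s' # c) = unfocus (Seq s s') c"

section \<open>Inversion of the matching relation\<close>

inductive_cases matches_ElemE: "matches G (Elem k) ts v"
inductive_cases matches_EpsE: "matches G (Eps u) ts v"
inductive_cases matches_DisjE: "matches G (Disj s1 s2) ts v"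
inductive_cases matches_SeqE: "matches G (Seq s1 s2) ts v"
inductive_cases matches_MapE: "matches G (Map f s) ts v"
inductive_cases matches_VarE: "matches G (Var x) ts v"

lemma matches_Elem_iff:
  "matches G (Elem k) ts v \<longleftrightarrow> ts = [v] \<and> v \<in> tokens G \<and> kind_of G v = k"
  by (auto elim: matches_ElemE intro: matches.elem)

lemma matches_Eps_iff: "matches G (Eps u) ts v \<longleftrightarrow> ts = [] \<and> u = v"
  by (auto elim: matches_EpsE intro: matches.eps)

lemma matches_Disj_iff: "matches G (Disj s1 s2) ts v \<longleftrightarrow> matches G s1 ts v \<or> matches G s2 ts v"
  by (auto elim: matches_DisjE intro: matches.disj1 matches.disj2)

lemma matches_Seq_iff:
  "matches G (Seq s1 s2) ts v \<longleftrightarrow>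
    (\<exists>ts1 ts2 v1 v2. ts = ts1 @ ts2 \<and> v = val_pair G v1 v2 \<and>
      matches G s1 ts1 v1 \<and> matches G s2 ts2 v2)"
  by (auto elim!: matches_SeqE intro: matches.seq)

lemma matches_Seq_Eps_iff:
  "matches G (Seq (Eps u) s) ts v \<longleftrightarrow> (\<exists>w. v = val_pair G u w \<and> matches G s ts w)"
  by (auto simp: matches_Seq_iff matches_Eps_iff)

lemma matches_Map_iff: "matches G (Map f s) ts v \<longleftrightarrow> (\<exists>w. v = f w \<and> matches G s ts w)"
  by (auto elim: matches_MapE intro: matches.map)

lemma matches_Var_iff: "matches G (Var x) ts v \<longleftrightarrow> matches G (get_def G x) ts v"
  by (auto elim: matches_VarE intro: matches.var)

section \<open>Nullability, productivity and first sets against matching\<close>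

lemma nullable_with_matches: "nullable_with G s v \<Longrightarrow> matches G s [] v"
proof (induction rule: nullable_with.induct)
  case (seq s1 v1 s2 v2)
  then show ?case
    using matches.seq[of G s1 "[]" v1 s2 "[]" v2] by simp
qed (auto intro: matches.intros)

lemma matches_Nil_nullable_with: "matches G s [] v \<Longrightarrow> nullable_with G s v"
  by (induction s "[] :: 'a list" v rule: matches.induct) (auto intro: nullable_with.intros)

lemma matches_Nil_iff: "matches G s [] v \<longleftrightarrow> nullable_with G s v"
  using nullable_with_matches matches_Nil_nullable_with by metis

lemma matches_productive: "matches G s ts v \<Longrightarrow> productive G s"
  by (induction rule: matches.induct) (auto intro: productive.intros)

lemma is_nullable_productive: "is_nullable G s \<Longrightarrow> productive G s"
  by (auto simp: is_nullable_def dest: nullable_with_matches matches_productive)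

text \<open>In a sequence, a left part that consumes something supplies the first token, and the
  right part is productive because it matches; a left part that consumes nothing is
  nullable.\<close>

lemma matches_Cons_FIRST:
  "matches G s ts v \<Longrightarrow> ts = t # ts' \<Longrightarrow> kind_of G t \<in> FIRST G s"
proof (induction arbitrary: t ts' rule: matches.induct)
  case (seq s1 ts1 v1 s2 ts2 v2)
  show ?case
  proof (cases ts1)
    case Nil
    then have "is_nullable G s1" "kind_of G t \<in> FIRST G s2"
      using seq by (auto simp: is_nullable_def matches_Nil_iff)
    then show ?thesis
      by (auto simp: FIRST_def intro: in_first.seq2)
  next
    case (Cons t1 ts1')
    then have "kind_of G t \<in> FIRST G s1" "productive G s2"
      using seq by (auto dest: matches_productive)
    then show ?thesis
      by (auto simp: FIRST_def intro: in_first.seq1)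
  qed
qed (auto simp: FIRST_def intro: in_first.intros)

lemma is_nullableI: "nullable_with G s v \<Longrightarrow> is_nullable G s"
  by (auto simp: is_nullable_def)

lemma FIRST_I: "in_first G k s \<Longrightarrow> k \<in> FIRST G s"
  by (simp add: FIRST_def)

text \<open>A null value and a first kind from different branches of a disjunction are what the
  mixed rules of \<open>in_snf\<close> record. A nullable sequence has two nullable parts, so the
  induction hypothesis applies to the part that supplies the kind.\<close>

lemma nullable_FIRST_SNF:
  assumes "in_first G k s" "nullable_with G s v"
  shows "k \<in> SNF G s"
  using assms
proof (induction arbitrary: v rule: in_first.induct)
  case (disj1 s1 s2)
  from disj1.prems show ?case
    by cases (use disj1 in
      \<open>auto simp: SNF_def intro: in_snf.disj1 in_snf.disj3 is_nullableI FIRST_I\<close>)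
next
  case (disj2 s2 s1)
  from disj2.prems show ?case
    by cases (use disj2 in
      \<open>auto simp: SNF_def intro: in_snf.disj2 in_snf.disj4 is_nullableI FIRST_I\<close>)
next
  case (seq1 s1 s2)
  from seq1.prems show ?case
    by cases (use seq1 in \<open>auto simp: SNF_def intro: in_snf.seq1 is_nullableI\<close>)
next
  case (seq2 s1 s2)
  from seq2.prems show ?case
    by cases (use seq2 in \<open>auto simp: SNF_def intro: in_snf.seq2 is_nullable_productive is_nullableI\<close>)
next
  case (map s f)
  from map.prems show ?case
    by cases (use map in \<open>auto simp: SNF_def intro: in_snf.map\<close>)
next
  case (var x)
  from var.prems show ?case
    by cases (use var in \<open>auto simp: SNF_def intro: in_snf.var\<close>)
qed (auto elim: nullable_with.cases)

text \<open>Only a disjunction offers a choice of derivations, and two nullable branches would be a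
  conflict.\<close>

lemma nullable_with_unique:
  "nullable_with G s v \<Longrightarrow> LL1 G s \<Longrightarrow> nullable_with G s w \<Longrightarrow> v = w"
  unfolding LL1_def
proof (induction arbitrary: w rule: nullable_with.induct)
  case (eps v)
  from eps.prems(2) show ?case by cases simp
next
  case (disj1 s1 v s2)
  from disj1.prems(2) show ?case
    by cases (use disj1 in \<open>auto intro: has_conflict.intros is_nullableI\<close>)
next
  case (disj2 s2 v s1)
  from disj2.prems(2) show ?case
    by cases (use disj2 in \<open>auto intro: has_conflict.intros is_nullableI\<close>)
next
  case (seq s1 v1 s2 v2)
  have "\<not> has_conflict G s1" "\<not> has_conflict G s2"
    using seq.prems(1) by (auto intro: has_conflict.intros)
  from seq.prems(2) show ?case
    by cases (use seq.IH \<open>\<not> has_conflict G s1\<close> \<open>\<not> has_conflict G s2\<close> in metis)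
next
  case (map s v f)
  have "\<not> has_conflict G s"
    using map.prems(1) by (auto intro: has_conflict.intros)
  from map.prems(2) show ?case
    by cases (use map.IH \<open>\<not> has_conflict G s\<close> in metis)
next
  case (var x v)
  have "\<not> has_conflict G (get_def G x)"
    using var.prems(1) by (auto intro: has_conflict.intros)
  from var.prems(2) show ?case
    by cases (use var.IH \<open>\<not> has_conflict G (get_def G x)\<close> in metis)
qed

text \<open>Uniqueness leaves a single candidate, so the arbitrary choice in \<open>nullable\<close>
  is harmless.\<close>

lemma nullable_eq_Some_iff:
  assumes "LL1 G s"
  shows "nullable G s = Some v \<longleftrightarrow> nullable_with G s v"
  using someI_ex[of "nullable_with G s"] nullable_with_unique[OF _ assms]
  by (auto simp: nullable_def is_nullable_def)

section \<open>Monotonicity of contexts in the syntax at the hole\<close>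

text \<open>
  Nullability and first sets are deliberately left out, so that \<open>Eps t\<close> may replace \<open>Elem k\<close>.
\<close>

definition hole_le ::
  "('v, 'ty, 'k, 'x) setting \<Rightarrow> ('v, 'k, 'x) syn \<Rightarrow> ('v, 'k, 'x) syn \<Rightarrow> bool" where
  "hole_le G s s' \<longleftrightarrow> (productive G s \<longrightarrow> productive G s') \<and> SNF G s \<subseteq> SNF G s' \<and>
    (has_conflict G s \<longrightarrow> has_conflict G s')"

inductive_cases productive_MapE: "productive G (Map f s)"
inductive_cases productive_SeqE: "productive G (Seq s1 s2)"
inductive_cases snf_EpsE: "in_snf G k (Eps v)"
inductive_cases snf_MapE: "in_snf G k (Map f s)"
inductive_cases snf_SeqE: "in_snf G k (Seq s1 s2)"
inductive_cases conflict_EpsE: "has_conflict G (Eps v)"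
inductive_cases conflict_MapE: "has_conflict G (Map f s)"
inductive_cases conflict_SeqE: "has_conflict G (Seq s1 s2)"

lemma hole_le_Map: "hole_le G s s' \<Longrightarrow> hole_le G (Map f s) (Map f s')"
  by (auto simp: hole_le_def SNF_def elim!: productive_MapE snf_MapE conflict_MapE
      intro: productive.intros in_snf.intros has_conflict.intros)

lemma conflict_SeqI: "in_snf G k s1 \<Longrightarrow> k \<in> FIRST G s2 \<Longrightarrow> has_conflict G (Seq s1 s2)"
  by (rule has_conflict.seq_follow) (auto simp: SNF_def)

lemma conflict_DisjI: "in_first G k s1 \<Longrightarrow> in_first G k s2 \<Longrightarrow> has_conflict G (Disj s1 s2)"
  by (rule has_conflict.disj_first) (auto simp: FIRST_def)

text \<open>Productivity, should-not-follow set and conflicts of a sequence depend on its left part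
  only through these same three properties.\<close>

lemma hole_le_Seq: "hole_le G s s' \<Longrightarrow> hole_le G (Seq s s2) (Seq s' s2)"
  unfolding hole_le_def SNF_def Collect_mono_iff
  by (auto simp: SNF_def elim!: productive_SeqE snf_SeqE conflict_SeqE
      intro: productive.seq in_snf.seq1 in_snf.seq2 conflict_SeqI
        has_conflict.seq1 has_conflict.seq2)

text \<open>First set and nullability of a right part matter only together with the
  should-not-follow set of the left part, which is empty for \<open>Eps\<close>. Used with
  \<open>s1\<close> an \<open>Eps\<close> for \<open>Prepend\<close> layers, and with
  \<open>s1\<close> a nullable left part that \<open>pierce\<close> skips.\<close>

lemma hole_le_Seq_Eps:
  assumes "hole_le G s s'" "productive G s1"
  shows "hole_le G (Seq (Eps v) s) (Seq s1 s')"
  using assms unfolding hole_le_def SNF_def Collect_mono_iff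
  by (auto simp: SNF_def elim!: productive_SeqE snf_SeqE conflict_SeqE elim: snf_EpsE conflict_EpsE
      intro: productive.seq in_snf.seq2 has_conflict.seq2)

lemma hole_le_refl: "hole_le G s s"
  by (simp add: hole_le_def)

text \<open>\<open>Eps\<close> has an empty should-not-follow set and no conflict. This allows a
  focus to be replaced by a value it has produced.\<close>

lemma hole_le_Eps: "productive G s \<Longrightarrow> hole_le G (Eps v) s"
  by (auto simp: hole_le_def SNF_def elim: snf_EpsE conflict_EpsE)

lemma hole_le_unfocus: "hole_le G s s' \<Longrightarrow> hole_le G (unfocus s c) (unfocus s' c)"
proof (induction c arbitrary: s s')
  case (Cons l c)
  then show ?case
    by (cases l) (auto intro: hole_le_Map hole_le_Seq hole_le_Seq_Eps productive.eps)
qed simp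

lemma LL1_unfocus_mono: "hole_le G s s' \<Longrightarrow> LL1 G (unfocus s' c) \<Longrightarrow> LL1 G (unfocus s c)"
  using hole_le_unfocus by (auto simp: hole_le_def LL1_def)

lemma LL1_unfocusD: "LL1 G (unfocus s c) \<Longrightarrow> LL1 G s"
proof (induction c arbitrary: s)
  case (Cons l c)
  then show ?case
    by (cases l) (auto simp: LL1_def intro: has_conflict.intros)
qed simp

section \<open>Matching through a context\<close>

lemma matches_unfocus_mono:
  assumes "\<And>ts v. matches G s ts v \<Longrightarrow> matches G s' ts v" "matches G (unfocus s c) ts v"
  shows "matches G (unfocus s' c) ts v"
  using assms
proof (induction c arbitrary: s s')
  case (Cons l c)
  show ?case
  proof (cases l)
    case (Apply f)
    then show ?thesis
      using Cons.IH[of "Map f s" "Map f s'"] Cons.prems by (auto simp: matches_Map_iff)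
  next
    case (Prepend u)
    have "matches G (Seq (Eps u) s') ts v" if "matches G (Seq (Eps u) s) ts v" for ts v
      using that Cons.prems(1) unfolding matches_Seq_iff by blast
    then show ?thesis
      using Cons.IH[of "Seq (Eps u) s" "Seq (Eps u) s'"] Cons.prems(2) Prepend by simp
  next
    case (Follow_by s2)
    have "matches G (Seq s' s2) ts v" if "matches G (Seq s s2) ts v" for ts v
      using that Cons.prems(1) unfolding matches_Seq_iff by blast
    then show ?thesis
      using Cons.IH[of "Seq s s2" "Seq s' s2"] Cons.prems(2) Follow_by by simp
  qed
qed simp

lemma matches_unfocus_cong:
  assumes "\<And>ts v. matches G s ts v \<longleftrightarrow> matches G s' ts v"
  shows "matches G (unfocus s c) ts v \<longleftrightarrow> matches G (unfocus s' c) ts v"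
  using matches_unfocus_mono[of G s s' c ts v] matches_unfocus_mono[of G s' s c ts v] assms
  by blast

lemma matches_unfocus_Map_Eps:
  "matches G (unfocus (Map f (Eps w)) c) ts v \<longleftrightarrow> matches G (unfocus (Eps (f w)) c) ts v"
  by (rule matches_unfocus_cong) (auto simp: matches_Map_iff matches_Eps_iff)

lemma matches_unfocus_Seq_Eps:
  "matches G (unfocus (Seq (Eps u) (Eps w)) c) ts v \<longleftrightarrow>
    matches G (unfocus (Eps (val_pair G u w)) c) ts v"
  by (rule matches_unfocus_cong) (auto simp: matches_Seq_iff matches_Eps_iff)

text \<open>The context can inspect the focus only through the value it produces, which an
  \<open>Eps\<close> can carry.\<close>

lemma matches_unfocus_iff:
  "matches G (unfocus s c) ts v \<longleftrightarrow>
    (\<exists>ts1 ts2 w. ts = ts1 @ ts2 \<and> matches G s ts1 w \<and> matches G (unfocus (Eps w) c) ts2 v)"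
proof (induction c arbitrary: s ts)
  case Nil
  then show ?case by (simp add: matches_Eps_iff)
next
  case (Cons l c)
  show ?case
  proof (cases l)
    case (Apply f)
    have "matches G (unfocus s (l # c)) ts v \<longleftrightarrow> (\<exists>ts1 ts2 w. ts = ts1 @ ts2 \<and>
        matches G (Map f s) ts1 w \<and> matches G (unfocus (Eps w) c) ts2 v)"
      using Cons.IH[of "Map f s" ts] Apply by simp
    then show ?thesis
      using Apply by (auto simp: matches_Map_iff matches_unfocus_Map_Eps)
  next
    case (Prepend u)
    have "matches G (unfocus s (l # c)) ts v \<longleftrightarrow> (\<exists>ts1 ts2 w. ts = ts1 @ ts2 \<and>
        matches G (Seq (Eps u) s) ts1 w \<and> matches G (unfocus (Eps w) c) ts2 v)"
      using Cons.IH[of "Seq (Eps u) s" ts] Prepend by simp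
    then show ?thesis
      using Prepend unfolding matches_Seq_Eps_iff by (auto simp: matches_unfocus_Seq_Eps)
  next
    case (Follow_by s2)
    \<comment> \<open>The left part \<open>s0\<close> is arbitrary because the equivalence is used
      both for \<open>s\<close> and for \<open>Eps w\<close>. The tokens then fall into three
      pieces: for the focus, for \<open>s2\<close> and for the outer context.\<close>
    have split: "matches G (unfocus (Seq s0 s2) c) ts v \<longleftrightarrow> (\<exists>ts1 ts2 w. ts = ts1 @ ts2 \<and>
        matches G (Seq s0 s2) ts1 w \<and> matches G (unfocus (Eps w) c) ts2 v)" for s0 ts
      by (rule Cons.IH)
    have "matches G (unfocus (Seq s s2) c) ts v \<longleftrightarrow> (\<exists>ts1 ts2 w. ts = ts1 @ ts2 \<and>
        matches G s ts1 w \<and> matches G (unfocus (Seq (Eps w) s2) c) ts2 v)" (is "?lhs \<longleftrightarrow> ?rhs")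
    proof
      assume ?lhs
      then obtain ts1 ts2 ts3 w w2 where "ts = (ts1 @ ts2) @ ts3" "matches G s ts1 w"
          "matches G s2 ts2 w2" "matches G (unfocus (Eps (val_pair G w w2)) c) ts3 v"
        unfolding split matches_Seq_iff by blast
      then show ?rhs
        unfolding split matches_Seq_Eps_iff by (metis append.assoc)
    next
      assume ?rhs
      then obtain ts1 ts2 ts3 w w2 where "ts = ts1 @ ts2 @ ts3" "matches G s ts1 w"
          "matches G s2 ts2 w2" "matches G (unfocus (Eps (val_pair G w w2)) c) ts3 v"
        unfolding split matches_Seq_Eps_iff by blast
      then show ?lhs
        unfolding split by (metis append.assoc matches.seq)
    qed
    then show ?thesis
      using Follow_by by simp
  qed
qed

section \<open>The next token under the LL(1) condition\<close>

text \<open>Going outward, the kind stays in the should-not-follow set past every follower that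
  matches the empty sequence, since such a follower is nullable. The follower that consumes the
  token has the kind in its first set, which is a sequence conflict.\<close>

lemma conflict_if_SNF_follows:
  assumes "matches G (unfocus (Eps w) c) (t # ts) v" "kind_of G t \<in> SNF G s"
  shows "has_conflict G (unfocus s c)"
  using assms
proof (induction c arbitrary: s w)
  case Nil
  then show ?case by (simp add: matches_Eps_iff)
next
  case (Cons l c)
  show ?case
  proof (cases l)
    case (Apply f)
    then show ?thesis
      using Cons.IH[of "f w" "Map f s"] Cons.prems
      by (auto simp: matches_unfocus_Map_Eps SNF_def intro: in_snf.map)
  next
    case (Prepend u)
    then show ?thesis
      using Cons.IH[of "val_pair G u w" "Seq (Eps u) s"] Cons.prems
      by (auto simp: matches_unfocus_Seq_Eps SNF_def intro: in_snf.seq2 productive.eps)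
  next
    case (Follow_by s2)
    then obtain ts1 ts2 w2 where split: "t # ts = ts1 @ ts2" "matches G s2 ts1 w2"
        "matches G (unfocus (Eps (val_pair G w w2)) c) ts2 v"
      using Cons.prems(1) matches_unfocus_iff[of G "Seq (Eps w) s2" c "t # ts" v]
      by (auto simp: matches_Seq_iff matches_Eps_iff)
    show ?thesis
    proof (cases ts1)
      case Nil
      then have "kind_of G t \<in> SNF G (Seq s s2)"
        using split(2) Cons.prems(2)
        by (auto simp: SNF_def matches_Nil_iff intro: in_snf.seq1 is_nullableI)
      then show ?thesis
        using Cons.IH[of "val_pair G w w2" "Seq s s2"] split Nil Follow_by by simp
    next
      case (Cons t1 ts1')
      then have "kind_of G t \<in> FIRST G s2"
        using split(1, 2) matches_Cons_FIRST by fastforce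
      then have "has_conflict G (Seq s s2)"
        using Cons.prems(2) by (auto intro: has_conflict.seq_follow)
      then show ?thesis
        using LL1_unfocusD[of G "Seq s s2" c] Follow_by by (auto simp: LL1_def)
    qed
  qed
qed

text \<open>Among the splittings of \<open>matches_unfocus_iff\<close>, those with an empty first
  part are excluded by \<open>nullable_FIRST_SNF\<close> and
  \<open>conflict_if_SNF_follows\<close>.\<close>

lemma matches_unfocus_FIRST_iff:
  assumes "LL1 G (unfocus s c)" "kind_of G t \<in> FIRST G s"
  shows "matches G (unfocus s c) (t # ts) v \<longleftrightarrow>
    (\<exists>ts1 ts2 w. ts = ts1 @ ts2 \<and> matches G s (t # ts1) w \<and> matches G (unfocus (Eps w) c) ts2 v)"
proof -
  have "\<not> (matches G s [] w \<and> matches G (unfocus (Eps w) c) (t # ts) v)" for w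
    using assms nullable_FIRST_SNF[of G "kind_of G t" s w]
      conflict_if_SNF_follows[of G w c t ts v s]
    by (auto simp: FIRST_def matches_Nil_iff LL1_def)
  then show ?thesis
    unfolding matches_unfocus_iff[of G s] Cons_eq_append_conv by auto
qed

text \<open>Agreement on sequences beginning with \<open>t\<close> suffices, so a focus may lose
  alternatives that start differently or match nothing.\<close>

lemma matches_unfocus_FIRST_cong:
  assumes "LL1 G (unfocus s c)" "LL1 G (unfocus s' c)"
    and "kind_of G t \<in> FIRST G s" "kind_of G t \<in> FIRST G s'"
    and "\<And>ts w. matches G s (t # ts) w \<longleftrightarrow> matches G s' (t # ts) w"
  shows "matches G (unfocus s c) (t # ts) v \<longleftrightarrow> matches G (unfocus s' c) (t # ts) v"
  using assms by (simp add: matches_unfocus_FIRST_iff)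

section \<open>Correctness of piercing\<close>

text \<open>For the moves of \<open>pierce\<close> that change the unfocused syntax. Moves that only
  shift material into the context leave \<open>unfocus\<close> unchanged.\<close>

lemma pierce_step:
  assumes "hole_le G s' s" "LL1 G (unfocus s c)"
    and "in_first G (kind_of G t) s" "in_first G (kind_of G t) s'"
    and "\<And>ts w. matches G s (t # ts) w \<longleftrightarrow> matches G s' (t # ts) w"
  shows "LL1 G (unfocus s' c) \<and>
    (\<forall>ts v. matches G (unfocus s c) (t # ts) v \<longleftrightarrow> matches G (unfocus s' c) (t # ts) v)"
  using LL1_unfocus_mono[OF assms(1,2)] matches_unfocus_FIRST_cong[of G s c s' t] assms
  by (simp add: FIRST_def)

lemma hole_le_Disj1: "hole_le G s1 (Disj s1 s2)"
  by (auto simp: hole_le_def SNF_def intro: productive.intros in_snf.intros has_conflict.intros)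

lemma hole_le_Disj2: "hole_le G s2 (Disj s1 s2)"
  by (auto simp: hole_le_def SNF_def intro: productive.intros in_snf.intros has_conflict.intros)

lemma hole_le_Var: "hole_le G (get_def G x) (Var x)"
  by (auto simp: hole_le_def SNF_def intro: productive.intros in_snf.intros has_conflict.intros)

text \<open>The derivation of first-set membership is a finite path that \<open>pierce\<close>
  retraces: without conflicts, each of its tests picks the branch of the derivation.
  \<open>Elem\<close> marks the place where the token is about to be consumed.\<close>

lemma pierce_correct:
  assumes "in_first G (kind_of G t) s" "LL1 G (unfocus s c)"
  shows "LL1 G (unfocus (Elem (kind_of G t)) (pierce G (kind_of G t) s c)) \<and>
    (\<forall>ts v. matches G (unfocus s c) (t # ts) v \<longleftrightarrow>
      matches G (unfocus (Elem (kind_of G t)) (pierce G (kind_of G t) s c)) (t # ts) v)"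
  using assms
proof (induction arbitrary: c rule: in_first.induct)
  case elem
  then show ?case by (simp add: pierce.simps)
next
  case (disj1 s1 s2)
  have "\<not> has_conflict G (Disj s1 s2)"
    using LL1_unfocusD[OF disj1.prems] by (simp add: LL1_def)
  then have "kind_of G t \<notin> FIRST G s2"
    using disj1.hyps by (auto simp: FIRST_def intro: conflict_DisjI)
  then have "LL1 G (unfocus s1 c) \<and> (\<forall>ts v. matches G (unfocus (Disj s1 s2) c) (t # ts) v \<longleftrightarrow>
      matches G (unfocus s1 c) (t # ts) v)"
    using disj1 by (intro pierce_step hole_le_Disj1)
      (auto simp: matches_Disj_iff dest: matches_Cons_FIRST intro: in_first.disj1)
  then show ?case
    using disj1.IH[of c] disj1.hyps by (simp add: pierce.simps[of G _ "Disj s1 s2"] FIRST_def)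
next
  case (disj2 s2 s1)
  have "\<not> has_conflict G (Disj s1 s2)"
    using LL1_unfocusD[OF disj2.prems] by (simp add: LL1_def)
  then have *: "kind_of G t \<notin> FIRST G s1"
    using disj2.hyps by (auto simp: FIRST_def intro: conflict_DisjI)
  then have "LL1 G (unfocus s2 c) \<and> (\<forall>ts v. matches G (unfocus (Disj s1 s2) c) (t # ts) v \<longleftrightarrow>
      matches G (unfocus s2 c) (t # ts) v)"
    using disj2 by (intro pierce_step hole_le_Disj2)
      (auto simp: matches_Disj_iff dest: matches_Cons_FIRST intro: in_first.disj2)
  then show ?case
    using disj2.IH[of c] * by (simp add: pierce.simps[of G _ "Disj s1 s2"])
next
  case (seq1 s1 s2)
  then have "pierce G (kind_of G t) (Seq s1 s2) c = pierce G (kind_of G t) s1 (Follow_by s2 # c)"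
    by (simp add: pierce.simps[of G _ "Seq s1 s2"] FIRST_def split: option.split)
  then show ?case
    using seq1.IH[of "Follow_by s2 # c"] seq1.prems by simp
next
  case (seq2 s1 s2)
  have LL1: "LL1 G (Seq s1 s2)"
    by (rule LL1_unfocusD[OF seq2.prems])
  then have LL1_s1: "LL1 G s1"
    by (auto simp: LL1_def intro: has_conflict.seq1)
  obtain u where u: "nullable_with G s1 u"
    using seq2.hyps by (auto simp: is_nullable_def)
  then have null: "nullable G s1 = Some u"
    using nullable_eq_Some_iff[OF LL1_s1] by simp
  \<comment> \<open>If the nullable \<open>s1\<close> could begin with the kind, its
    should-not-follow set would meet the first set of \<open>s2\<close>.\<close>
  have notin: "kind_of G t \<notin> FIRST G s1"
    using LL1 seq2.hyps(2) nullable_FIRST_SNF[OF _ u, of "kind_of G t"]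
      conflict_SeqI[of G "kind_of G t" s1 s2]
    by (auto simp: LL1_def FIRST_def SNF_def)
  \<comment> \<open>Before \<open>t\<close> the left part can only match the empty sequence, and its
    only null value is \<open>u\<close>.\<close>
  have "matches G (Seq s1 s2) (t # ts) w \<longleftrightarrow> matches G (Seq (Eps u) s2) (t # ts) w" for ts w
  proof -
    have "ts1 = [] \<and> v1 = u" if "matches G s1 ts1 v1" "t # ts = ts1 @ ts2" for ts1 ts2 v1
    proof (cases ts1)
      case Nil
      then show ?thesis
        using that u LL1_s1 nullable_with_unique by (auto simp: matches_Nil_iff)
    next
      case (Cons t' ts')
      then show ?thesis
        using that notin matches_Cons_FIRST by fastforce
    qed
    moreover have "matches G s1 [] u"
      by (rule nullable_with_matches[OF u])
    ultimately show ?thesis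
      unfolding matches_Seq_iff matches_Eps_iff by blast
  qed
  then have "LL1 G (unfocus (Seq (Eps u) s2) c) \<and>
      (\<forall>ts v. matches G (unfocus (Seq s1 s2) c) (t # ts) v \<longleftrightarrow>
        matches G (unfocus (Seq (Eps u) s2) c) (t # ts) v)"
    using seq2 by (intro pierce_step hole_le_Seq_Eps)
      (auto intro: in_first.seq2 nullable_with.eps hole_le_refl is_nullable_productive
        is_nullableI)
  then show ?case
    using seq2.IH[of "Prepend u # c"] notin null by (simp add: pierce.simps[of G _ "Seq s1 s2"])
next
  case (map s f)
  then show ?case
    using map.IH[of "Apply f # c"] by (simp add: pierce.simps[of G _ "Map f s"])
next
  case (var x)
  then have "LL1 G (unfocus (get_def G x) c) \<and>
      (\<forall>ts v. matches G (unfocus (Var x) c) (t # ts) v \<longleftrightarrow>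
        matches G (unfocus (get_def G x) c) (t # ts) v)"
    by (intro pierce_step hole_le_Var) (auto simp: matches_Var_iff intro: in_first.var)
  then show ?case
    using var.IH[of c] by (simp add: pierce.simps[of G _ "Var x"])
qed

section \<open>Plugging and locating\<close>

lemma matches_unfocus_plug:
  "plug G w c = (s', c') \<Longrightarrow>
    matches G (unfocus s' c') ts v \<longleftrightarrow> matches G (unfocus (Eps w) c) ts v"
  by (induction G w c rule: plug.induct)
    (auto simp: matches_unfocus_Map_Eps matches_unfocus_Seq_Eps)

text \<open>Collapsing an \<open>Apply\<close> or \<open>Prepend\<close> layer replaces a productive
  focus by an \<open>Eps\<close>; at a \<open>Follow_by\<close> layer the unfocused term stays the
  same.\<close>

lemma LL1_unfocus_plug:
  "plug G w c = (s', c') \<Longrightarrow> LL1 G (unfocus (Eps w) c) \<Longrightarrow> LL1 G (unfocus s' c')"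
proof (induction G w c rule: plug.induct)
  case (2 G w f c)
  have "LL1 G (unfocus (Eps (f w)) c)"
    using "2.prems"(2)
    by (intro LL1_unfocus_mono[OF hole_le_Eps, of G "Map f (Eps w)"] productive.intros) simp
  then show ?case
    using 2 by simp
next
  case (3 G w u c)
  have "LL1 G (unfocus (Eps (val_pair G u w)) c)"
    using "3.prems"(2)
    by (intro LL1_unfocus_mono[OF hole_le_Eps, of G "Seq (Eps u) (Eps w)"] productive.intros) simp
  then show ?case
    using 3 by simp
qed auto

lemma LL1_unfocus_plug_nullable:
  assumes "LL1 G (unfocus s c)" "nullable G s = Some w" "plug G w c = (s', c')"
  shows "LL1 G (unfocus s' c')"
proof -
  have "is_nullable G s"
    using assms(2) by (auto simp: nullable_def split: if_splits)
  then show ?thesis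
    using assms LL1_unfocus_mono[OF hole_le_Eps] LL1_unfocus_plug is_nullable_productive by metis
qed

text \<open>Shared by \<open>locate\<close> and \<open>result\<close>: the last assumption holds
  when the next kind is outside the first set, and trivially when \<open>ts\<close> is empty. The
  focus then contributes only its unique null value.\<close>

lemma matches_unfocus_plug_nullable:
  assumes "LL1 G (unfocus s c)" "nullable G s = Some w" "plug G w c = (s', c')"
    and "\<And>ts1 ts2 u. ts = ts1 @ ts2 \<Longrightarrow> matches G s ts1 u \<Longrightarrow> ts1 = []"
  shows "matches G (unfocus s c) ts v \<longleftrightarrow> matches G (unfocus s' c') ts v"
proof -
  have "LL1 G s"
    using assms(1) by (rule LL1_unfocusD)
  then have "matches G s [] u \<longleftrightarrow> u = w" for u
    using assms(2) by (auto simp: matches_Nil_iff simp flip: nullable_eq_Some_iff)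
  then have "matches G (unfocus s c) ts v \<longleftrightarrow> matches G (unfocus (Eps w) c) ts v"
    unfolding matches_unfocus_iff[of G s] using assms(4) by (metis append_Nil)
  then show ?thesis
    using matches_unfocus_plug[OF assms(3)] by simp
qed

lemma matches_Nil_nullable_None: "nullable G s = None \<Longrightarrow> \<not> matches G s [] v"
  by (auto simp: nullable_def is_nullable_def matches_Nil_iff split: if_splits)

lemma not_FIRST_matches_Nil:
  "kind_of G t \<notin> FIRST G s \<Longrightarrow> t # ts = ts1 @ ts2 \<Longrightarrow> matches G s ts1 v \<Longrightarrow> ts1 = []"
  using matches_Cons_FIRST by (cases ts1) fastforce+

text \<open>A focus whose first set lacks the kind can only match the empty sequence here, so it is
  plugged away or, if not nullable, excludes every match. The induction uses the measure that makes
  \<open>locate\<close> terminate.\<close>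

lemma locate_correct:
  assumes "LL1 G (unfocus s c)"
  shows "case locate G (kind_of G t) (s, c) of
      None \<Rightarrow> \<not> matches G (unfocus s c) (t # ts) v
    | Some (s', c') \<Rightarrow> in_first G (kind_of G t) s' \<and> LL1 G (unfocus s' c') \<and>
        (matches G (unfocus s c) (t # ts) v \<longleftrightarrow> matches G (unfocus s' c') (t # ts) v)"
  using assms
proof (induction "plug_measure c" arbitrary: s c rule: less_induct)
  case less
  show ?case
  proof (cases "kind_of G t \<in> FIRST G s")
    case True
    then show ?thesis
      using less.prems by (simp add: FIRST_def)
  next
    case notin: False
    show ?thesis
    proof (cases "nullable G s")
      case None
      then have "\<not> matches G (unfocus s c) (t # ts) v"
        using matches_unfocus_iff[of G s] not_FIRST_matches_Nil[OF notin]
          matches_Nil_nullable_None by metis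
      then show ?thesis
        using None notin by simp
    next
      case (Some w)
      show ?thesis
      proof (cases "c = []")
        case True
        \<comment> \<open>In the empty context nothing is left to consume the token, in agreement
          with the outcome \<open>None\<close>.\<close>
        then show ?thesis
          using Some notin matches_Cons_FIRST by fastforce
      next
        case False
        obtain s' c' where plug: "plug G w c = (s', c')"
          by fastforce
        have "matches G (unfocus s c) (t # ts) v \<longleftrightarrow> matches G (unfocus s' c') (t # ts) v"
          using not_FIRST_matches_Nil[OF notin]
          by (intro matches_unfocus_plug_nullable[OF less.prems Some plug])
        moreover have "plug_measure c' < plug_measure c"
          using plug_measure_less[OF False, of G w] plug by simp
        moreover have "LL1 G (unfocus s' c')"
          by (rule LL1_unfocus_plug_nullable[OF less.prems Some plug])
        ultimately show ?thesis
          using less.hyps[of c' s'] Some notin False plug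
          by (simp del: locate.simps add: locate.simps[of G _ s c] split: option.splits prod.splits)
      qed
    qed
  qed
qed

section \<open>Results at the end of the input\<close>

lemma result_correct:
  assumes "LL1 G (unfocus s c)"
  shows "result G (s, c) = Some v \<longleftrightarrow> matches G (unfocus s c) [] v"
  using assms
proof (induction "plug_measure c" arbitrary: s c rule: less_induct)
  case less
  show ?case
  proof (cases "nullable G s")
    case None
    then have "\<not> matches G (unfocus s c) [] v"
      using matches_unfocus_iff[of G s c "[]" v] matches_Nil_nullable_None[OF None] by auto
    then show ?thesis
      using None by simp
  next
    case (Some w)
    show ?thesis
    proof (cases "c = []")
      case True
      then show ?thesis
        using Some less.prems nullable_eq_Some_iff[of G s] by (auto simp: matches_Nil_iff)
    next
      case False
      obtain s' c' where plug: "plug G w c = (s', c')"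
        by fastforce
      have "matches G (unfocus s c) [] v \<longleftrightarrow> matches G (unfocus s' c') [] v"
        by (intro matches_unfocus_plug_nullable[OF less.prems Some plug]) simp
      moreover have "plug_measure c' < plug_measure c"
        using plug_measure_less[OF False, of G w] plug by simp
      moreover have "LL1 G (unfocus s' c')"
        by (rule LL1_unfocus_plug_nullable[OF less.prems Some plug])
      ultimately show ?thesis
        using less.hyps[of c' s'] Some False plug
        by (simp del: result.simps add: result.simps[of G s c])
    qed
  qed
qed

section \<open>Token derivation and parsing\<close>

text \<open>This consumes the token: in a sequence starting with \<open>t\<close>, the hole left by
  \<open>pierce\<close> can only match \<open>[t]\<close>, with value \<open>t\<close>.\<close>

lemma matches_unfocus_Elem_Cons_iff:
  assumes "t \<in> tokens G"
  shows "matches G (unfocus (Elem (kind_of G t)) c) (t # ts) v \<longleftrightarrow>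
    matches G (unfocus (Eps t) c) ts v"
  unfolding matches_unfocus_iff[of G "Elem (kind_of G t)"] matches_Elem_iff
  using assms by (fastforce intro: exI[of _ "[t]"])

lemma derive_token_correct:
  assumes "LL1 G (unfocus s c)" "t \<in> tokens G"
  shows "case derive_token G t (s, c) of
      None \<Rightarrow> \<not> matches G (unfocus s c) (t # ts) v
    | Some (s', c') \<Rightarrow> LL1 G (unfocus s' c') \<and>
        (matches G (unfocus s c) (t # ts) v \<longleftrightarrow> matches G (unfocus s' c') ts v)"
proof (cases "locate G (kind_of G t) (s, c)")
  case None
  then show ?thesis
    using locate_correct[OF assms(1), of t ts v] by (simp add: derive_token_def)
next
  case (Some sc)
  obtain s' c' where sc: "sc = (s', c')"
    by fastforce
  have located: "in_first G (kind_of G t) s'" "LL1 G (unfocus s' c')"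
      "matches G (unfocus s c) (t # ts) v \<longleftrightarrow> matches G (unfocus s' c') (t # ts) v"
    using locate_correct[OF assms(1), of t ts v] Some sc by auto
  let ?c = "pierce G (kind_of G t) s' c'"
  have pierced: "LL1 G (unfocus (Elem (kind_of G t)) ?c)"
      "matches G (unfocus s' c') (t # ts) v \<longleftrightarrow>
        matches G (unfocus (Elem (kind_of G t)) ?c) (t # ts) v"
    using pierce_correct[OF located(1,2)] by auto
  \<comment> \<open>\<open>Elem\<close> and \<open>Eps\<close> differ in nullability and first set,
    which \<open>hole_le\<close> ignores, so LL(1) survives the replacement.\<close>
  have "LL1 G (unfocus (Eps t) ?c)"
    by (rule LL1_unfocus_mono[OF hole_le_Eps[OF productive.elem] pierced(1)])
  then show ?thesis
    using located(3) pierced(2) matches_unfocus_Elem_Cons_iff[OF assms(2)] Some sc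
    by (simp add: derive_token_def del: locate.simps)
qed

text \<open>The context is arbitrary because deriving a token changes both focus and context; LL(1)
  of the unfocused syntax is the invariant.\<close>

lemma parse_correct:
  assumes "LL1 G (unfocus s c)" "set ts \<subseteq> tokens G"
  shows "parse G (s, c) ts = Some v \<longleftrightarrow> matches G (unfocus s c) ts v"
  using assms
proof (induction ts arbitrary: s c)
  case Nil
  then show ?case by (simp add: result_correct del: result.simps)
next
  case (Cons t ts)
  have step: "case derive_token G t (s, c) of
      None \<Rightarrow> \<not> matches G (unfocus s c) (t # ts) v
    | Some (s', c') \<Rightarrow> LL1 G (unfocus s' c') \<and>
        (matches G (unfocus s c) (t # ts) v \<longleftrightarrow> matches G (unfocus s' c') ts v)"
    using Cons.prems by (intro derive_token_correct) simp_all
  show ?case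
  proof (cases "derive_token G t (s, c)")
    case None
    then show ?thesis
      using step by simp
  next
    case (Some sc)
    obtain s' c' where "sc = (s', c')"
      by fastforce
    then show ?thesis
      using step Some Cons.IH[of s' c'] Cons.prems(2) by simp
  qed
qed

theorem theorem6p12:
  fixes G :: "('v, 'ty, 'k, 'x) setting"
    and T :: 'ty
    and s :: "('v, 'k, 'x) syn"
    and ts :: "'v list"
    and v :: 'v
  assumes "syntax_setting G"
    and "is_syntax G T s"
    and "LL1 G s"
    and "set ts \<subseteq> tokens G"
  shows "parse G (focus s) ts = Some v \<longleftrightarrow> matches G s ts v"
  \<comment> \<open>\<open>unfocus s []\<close> is \<open>s\<close>, so the invariant holds at the
    start.\<close>
  using parse_correct[of G s "[]" ts v] assms by (simp add: focus_def)

end
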